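(* Let $G$ be a locally compact group and let $(\pi,\mathcal{H})$ be a unitary, square-integrable representation of $G$ on a Hilbert space $\mathcal{H}$. Let $g\in\mathcal{H}$, $g\neq 0$, be nice, let $(x_j)_{j\in J}$ be a family of points of $G$ such that $\{\pi(x_j)g : j\in J\}$ is a frame for $\mathcal{H}$, and let $\{h_j : j\in J\}$ be a dual frame (not necessarily the canonical one). For a compact set $M\subseteq G$ and $y\in G$ let $P_{M,y}$ denote the orthogonal projection from $\mathcal{H}$ onto $V(yM)=\mathrm{span}\{h_j : x_j\in yM\}$. Then for every $f\in\mathcal{H}$ and every $\epsilon>0$ there exists a compact set $L\subseteq G$ (depending on $f$ and $\epsilon$) such that $$\sup_{x\in yK}\|\pi(x)f-P_{KL,y}\,\pi(x)f\|<\epsilon$$ holds for all compact sets $K\subseteq G$ and all $y\in G$.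
   Context: $G$ carries left Haar measure $dx$. Fix a symmetric compact neighborhood $U=U^{-1}\subseteq G$ of the identity $e$. For a function $F$ on $G$ the local maximum function is $F^\sharp(x)=\sup_{y\in xU}|F(y)|$, and the left amalgam space $W(L^\infty,L^2)$ is defined by the norm $\|F\|_{W(L^\infty,L^2)}=\|F^\sharp\|_{L^2(G)}$, i.e. it consists of the $F$ for which this norm is finite. For $g\in\mathcal{H}$ and $f\in\mathcal{H}$, set $V_gf(x)=\langle f,\pi(x)g\rangle$, $x\in G$. Unitary representations are strongly continuous. Square-integrable means that there is a nonzero $g_0\in\mathcal{H}$ with $V_{g_0}f\in L^2(G)$ for all $f\in\mathcal{H}$. A vector $g\in\mathcal{H}$ is called nice if $V_gf\in W(L^\infty,L^2)$ for every $f\in\mathcal{H}$. The family $\{\pi(x_j)g : j\in J\}$ is a frame for $\mathcal{H}$ if there are constants $A,B>0$ with $A\|f\|^2\le\sum_j|\langle f,\pi(x_j)g\rangle|^2\le B\|f\|^2$ for all $f\in\mathcal{H}$. A dual frame is a frame $\{h_j : j\in J\}$ of $\mathcal{H}$ such that $f=\sum_j\langle f,\pi(x_j)g\rangle h_j$ for all $f\in\mathcal{H}$. For sets $K,L\subseteq G$ and $y\in G$, $yKL=\{ykl : k\in K,\ l\in L\}$. *)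

theory Defs
  imports "HOL-Analysis.Analysis" "HOL-Library.Set_Algebras"
begin

section \<open>Complex Hilbert spaces\<close>

text \<open>The inner product \<open>cinner\<close> is linear in its first argument. The real inner product of the
  superclass is its real part, so that \<open>norm\<close> is the norm induced by \<open>cinner\<close>.\<close>

class chilbert_space = real_inner + banach +
  fixes scaleC :: "complex \<Rightarrow> 'a \<Rightarrow> 'a"  (infixr \<open>*\<^sub>C\<close> 75)
    and cinner :: "'a \<Rightarrow> 'a \<Rightarrow> complex"
  assumes scaleC_add_right: "c *\<^sub>C (x + y) = c *\<^sub>C x + c *\<^sub>C y"
    and scaleC_add_left: "(c + d) *\<^sub>C x = c *\<^sub>C x + d *\<^sub>C x"
    and scaleC_scaleC: "c *\<^sub>C d *\<^sub>C x = (c * d) *\<^sub>C x"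
    and scaleC_of_real: "complex_of_real r *\<^sub>C x = r *\<^sub>R x"
    and cinner_add_left: "cinner (x + y) z = cinner x z + cinner y z"
    and cinner_scaleC_left: "cinner (c *\<^sub>C x) y = c * cinner x y"
    and cinner_commute: "cinner x y = cnj (cinner y x)"
    and inner_eq_Re_cinner: "inner x y = Re (cinner x y)"

instantiation complex :: chilbert_space
begin

definition "c *\<^sub>C z = c * (z :: complex)"

definition "cinner w z = w * cnj (z :: complex)"

instance
  by standard
    (auto simp: scaleC_complex_def cinner_complex_def inner_complex_def algebra_simps scaleR_conv_of_real)

end

global_interpretation complex_vector: vector_space "scaleC :: complex \<Rightarrow> 'a \<Rightarrow> 'a :: chilbert_space"
  defines cspan = complex_vector.span
proof
  show "1 *\<^sub>C x = x" for x :: 'a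
    using scaleC_of_real [of 1 x] by simp
qed (simp_all add: scaleC_add_right scaleC_add_left scaleC_scaleC)

text \<open>At most one such \<open>v\<close> exists when \<open>V\<close> is a complex subspace; one exists for every \<open>f\<close> when
  \<open>V\<close> is moreover closed, in particular when it is finite-dimensional.\<close>

definition orth_proj :: "'a::chilbert_space set \<Rightarrow> 'a \<Rightarrow> 'a" where
  "orth_proj V f = (THE v. v \<in> V \<and> (\<forall>w\<in>V. cinner (f - v) w = 0))"

definition frame :: "'j set \<Rightarrow> ('j \<Rightarrow> 'a::chilbert_space) \<Rightarrow> bool" where
  "frame J e \<longleftrightarrow> (\<exists>A>0. \<exists>B>0. \<forall>f.
     (\<lambda>j. (cmod (cinner f (e j)))\<^sup>2) summable_on J \<and>
     A * (norm f)\<^sup>2 \<le> (\<Sum>\<^sub>\<infinity>j\<in>J. (cmod (cinner f (e j)))\<^sup>2) \<and>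
     (\<Sum>\<^sub>\<infinity>j\<in>J. (cmod (cinner f (e j)))\<^sup>2) \<le> B * (norm f)\<^sup>2)"

definition dual_frame :: "'j set \<Rightarrow> ('j \<Rightarrow> 'a::chilbert_space) \<Rightarrow> ('j \<Rightarrow> 'a) \<Rightarrow> bool" where
  "dual_frame J e h \<longleftrightarrow>
     frame J h \<and> (\<forall>f. ((\<lambda>j. cinner f (e j) *\<^sub>C h j) has_sum f) J)"

section \<open>Locally compact groups and their unitary representations\<close>

text \<open>Groups are written additively, as the library's class of topological groups does; it does
  not assume commutativity. So \<open>x + y\<close> is the product \<open>xy\<close>, \<open>0\<close> the identity, \<open>x +o A\<close> the left
  translate \<open>xA\<close> and \<open>K + L\<close> the product set \<open>KL\<close>.\<close>

definition left_haar_measure :: "'g::{topological_group_add, t2_space} measure \<Rightarrow> bool" where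
  "left_haar_measure \<mu> \<longleftrightarrow>
     sets \<mu> = sets borel \<and>
     emeasure \<mu> UNIV \<noteq> 0 \<and>
     (\<forall>x. \<forall>A\<in>sets borel. emeasure \<mu> (x +o A) = emeasure \<mu> A) \<and>
     (\<forall>K. compact K \<longrightarrow> emeasure \<mu> K < \<infinity>) \<and>
     (\<forall>A\<in>sets borel. emeasure \<mu> A = (INF W\<in>{W. open W \<and> A \<subseteq> W}. emeasure \<mu> W)) \<and>
     (\<forall>W. open W \<longrightarrow> emeasure \<mu> W = (SUP K\<in>{K. compact K \<and> K \<subseteq> W}. emeasure \<mu> K))"

definition unitary_op :: "('a::chilbert_space \<Rightarrow> 'a) \<Rightarrow> bool" where
  "unitary_op T \<longleftrightarrow>
     Vector_Spaces.linear scaleC scaleC T \<and> surj T \<and> (\<forall>f g. cinner (T f) (T g) = cinner f g)"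

definition unitary_rep ::
    "('g::{topological_group_add, t2_space} \<Rightarrow> 'a::chilbert_space \<Rightarrow> 'a) \<Rightarrow> bool" where
  "unitary_rep \<pi> \<longleftrightarrow>
     (\<forall>x. unitary_op (\<pi> x)) \<and>
     (\<forall>x y. \<pi> (x + y) = \<pi> x \<circ> \<pi> y) \<and>
     (\<forall>f. continuous_on UNIV (\<lambda>x. \<pi> x f))"

definition voice_transform ::
    "('g \<Rightarrow> 'a::chilbert_space \<Rightarrow> 'a) \<Rightarrow> 'a \<Rightarrow> 'a \<Rightarrow> 'g \<Rightarrow> complex" where
  "voice_transform \<pi> g f x = cinner f (\<pi> x g)"

definition in_L2 :: "'g measure \<Rightarrow> ('g \<Rightarrow> complex) \<Rightarrow> bool" where
  "in_L2 \<mu> F \<longleftrightarrow> F \<in> borel_measurable \<mu> \<and> (\<integral>\<^sup>+x. (ennreal (cmod (F x)))\<^sup>2 \<partial>\<mu>) < \<infinity>"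

definition square_integrable_rep ::
    "'g measure \<Rightarrow> ('g \<Rightarrow> 'a::chilbert_space \<Rightarrow> 'a) \<Rightarrow> bool" where
  "square_integrable_rep \<mu> \<pi> \<longleftrightarrow> (\<exists>g\<^sub>0. g\<^sub>0 \<noteq> 0 \<and> (\<forall>f. in_L2 \<mu> (voice_transform \<pi> g\<^sub>0 f)))"

definition local_max :: "'g::plus set \<Rightarrow> ('g \<Rightarrow> complex) \<Rightarrow> 'g \<Rightarrow> ennreal" where
  "local_max U F x = (SUP y\<in>x +o U. ennreal (cmod (F y)))"

definition in_amalgam :: "'g::plus measure \<Rightarrow> 'g set \<Rightarrow> ('g \<Rightarrow> complex) \<Rightarrow> bool" where
  "in_amalgam \<mu> U F \<longleftrightarrow>
     local_max U F \<in> borel_measurable \<mu> \<and> (\<integral>\<^sup>+x. (local_max U F x)\<^sup>2 \<partial>\<mu>) < \<infinity>"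

definition nice ::
    "'g::plus measure \<Rightarrow> 'g set \<Rightarrow> ('g \<Rightarrow> 'a::chilbert_space \<Rightarrow> 'a) \<Rightarrow> 'a \<Rightarrow> bool" where
  "nice \<mu> U \<pi> g \<longleftrightarrow> (\<forall>f. in_amalgam \<mu> U (voice_transform \<pi> g f))"

definition local_span ::
    "'j set \<Rightarrow> ('j \<Rightarrow> 'g) \<Rightarrow> ('j \<Rightarrow> 'a::chilbert_space) \<Rightarrow> 'g set \<Rightarrow> 'a set" where
  "local_span J x h S = cspan (h ` {j \<in> J. x j \<in> S})"

end

theory Submission
  imports Defs
begin

text \<open>With \<open>F = voice_transform \<pi> g f\<close>, the coefficients of \<open>\<pi> z f\<close> in the dual frame
  expansion are \<open>F (- z + x j)\<close>. For \<open>z\<close> in \<open>y +o K\<close>, discarding the finitely many \<open>j\<close> with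
  \<open>x j\<close> in \<open>y +o (K + L)\<close> leaves only sample points \<open>- z + x j\<close> outside \<open>L\<close>; by the Bessel bound
  of \<open>h\<close> the squared error is at most a constant times the sum of \<open>\<bar>F (- z + x j)\<bar>\<^sup>2\<close> over these \<open>j\<close>.
  The points \<open>x j\<close>, hence all their translates, are relatively separated, so this sum is bounded by
  the integral of the square of the local maximum function of \<open>F\<close> off a compact set, which is small
  uniformly in \<open>z\<close>.\<close>

section \<open>Complex inner products and Cauchy-Schwarz\<close>

lemma cinner_add_right: "cinner x (y + z) = cinner x y + cinner x (z :: 'a::chilbert_space)"
  by (metis cinner_add_left cinner_commute complex_cnj_add)

lemma cinner_scaleC_right: "cinner x (c *\<^sub>C y) = cnj c * cinner x (y :: 'a::chilbert_space)"
  by (metis cinner_scaleC_left cinner_commute complex_cnj_mult)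

lemma cinner_zero_left [simp]: "cinner 0 (y :: 'a::chilbert_space) = 0"
  using cinner_add_left [of 0 0 y] by simp

lemma cinner_zero_right [simp]: "cinner y (0 :: 'a::chilbert_space) = 0"
  using cinner_add_right [of y 0 0] by simp

lemma cinner_diff_left: "cinner (x - y) z = cinner x z - cinner y (z :: 'a::chilbert_space)"
  using cinner_add_left [of "x - y" y z] by simp

lemma cinner_diff_right: "cinner z (x - y) = cinner z x - cinner z (y :: 'a::chilbert_space)"
  using cinner_add_right [of z "x - y" y] by simp

lemma cinner_sum_left:
  "cinner (\<Sum>i\<in>T. f i) (z :: 'a::chilbert_space) = (\<Sum>i\<in>T. cinner (f i) z)"
  by (induction T rule: infinite_finite_induct) (auto simp: cinner_add_left)

lemma cinner_self: "cinner x x = complex_of_real ((norm (x :: 'a::chilbert_space))\<^sup>2)"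
proof (rule complex_eqI)
  show "Re (cinner x x) = Re (complex_of_real ((norm x)\<^sup>2))"
    using inner_eq_Re_cinner [of x x] by (simp add: power2_norm_eq_inner)
  have "Im (cinner x x) = - Im (cinner x x)"
    using arg_cong [OF cinner_commute [of x x], of Im] by simp
  then show "Im (cinner x x) = Im (complex_of_real ((norm x)\<^sup>2))"
    by simp
qed

lemma norm_scaleC: "norm (c *\<^sub>C (x :: 'a::chilbert_space)) = cmod c * norm x"
proof -
  have "complex_of_real ((norm (c *\<^sub>C x))\<^sup>2) = (c * cnj c) * cinner x x"
    by (simp only: cinner_self [symmetric] cinner_scaleC_left cinner_scaleC_right mult.assoc
        mult.left_commute)
  also have "\<dots> = complex_of_real ((cmod c * norm x)\<^sup>2)"
    by (simp add: cinner_self power_mult_distrib flip: complex_norm_square)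
  finally have "(norm (c *\<^sub>C x))\<^sup>2 = (cmod c * norm x)\<^sup>2"
    using of_real_eq_iff by blast
  then show ?thesis
    by (simp add: power2_eq_iff_nonneg)
qed

text \<open>Rotating \<open>x\<close> by a unimodular scalar makes the inner product real and
  nonnegative, so the Cauchy-Schwarz inequality of the underlying real inner product
  applies.\<close>

lemma cmod_cinner_le: "cmod (cinner x (y :: 'a::chilbert_space)) \<le> norm x * norm y"
proof (cases "cinner x y = 0")
  case False
  define c where "c = cnj (sgn (cinner x y))"
  have c: "cmod c = 1"
    using False by (simp add: c_def norm_sgn)
  have "c * cinner x y = complex_of_real (cmod (cinner x y))"
    using False by (simp add: c_def sgn_eq complex_norm_square [symmetric] power2_eq_square
        flip: mult.commute)
  then have "cmod (cinner x y) = inner (c *\<^sub>C x) y"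
    by (simp add: inner_eq_Re_cinner cinner_scaleC_left)
  also have "\<dots> \<le> norm (c *\<^sub>C x) * norm y"
    by (rule norm_cauchy_schwarz)
  finally show ?thesis
    by (simp add: norm_scaleC c)
qed auto

section \<open>Orthogonal projection onto finitely generated subspaces\<close>

lemma cinner_cspan_eq_0:
  fixes u :: "'a::chilbert_space"
  assumes "w \<in> cspan B" and "\<And>b. b \<in> B \<Longrightarrow> cinner u b = 0"
  shows "cinner u w = 0"
  using assms(1)
proof (induction rule: complex_vector.span_induct_alt)
  case base
  then show ?case by simp
next
  case (step c x y)
  then show ?case
    by (simp add: assms(2) cinner_add_right cinner_scaleC_right)
qed

text \<open>Gram-Schmidt induction: a new generator \<open>a\<close> is replaced by its component
  \<open>d\<close> orthogonal to the old span, and the projection \<open>p\<close> onto the old span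
  is corrected by a multiple of \<open>d\<close>.\<close>

lemma ex_orthogonal_projection:
  fixes f :: "'a::chilbert_space"
  assumes "finite B"
  shows "\<exists>v\<in>cspan B. \<forall>w\<in>cspan B. cinner (f - v) w = 0"
  using assms
proof (induction B arbitrary: f rule: finite_induct)
  case empty
  then show ?case
    by (auto simp: complex_vector.span_empty)
next
  case (insert a B)
  obtain p where p: "p \<in> cspan B" "\<And>w. w \<in> cspan B \<Longrightarrow> cinner (f - p) w = 0"
    using insert.IH by blast
  obtain q where q: "q \<in> cspan B" "\<And>w. w \<in> cspan B \<Longrightarrow> cinner (a - q) w = 0"
    using insert.IH by blast
  define d where "d = a - q"
  \<comment> \<open>If \<open>a\<close> already lies in the old span, then \<open>d = 0\<close>; the
    quotient is then 0 by convention and \<open>v = p\<close>.\<close>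
  define c where "c = cinner (f - p) d / cinner d d"
  define v where "v = p + c *\<^sub>C d"
  have mono: "u \<in> cspan (insert a B)" if "u \<in> cspan B" for u
    using that complex_vector.span_mono [of B "insert a B"] by blast
  have "a \<in> cspan (insert a B)"
    by (rule complex_vector.span_base) simp
  then have v_in: "v \<in> cspan (insert a B)"
    unfolding v_def d_def
    using p(1) q(1)
    by (intro complex_vector.span_add complex_vector.span_scale complex_vector.span_diff)
      (auto intro: mono)
  have B: "cinner (f - v) w = 0" if "w \<in> cspan B" for w
    using p(2) [OF that] q(2) [OF that]
    by (simp add: v_def d_def cinner_diff_left cinner_add_left cinner_scaleC_left)
  have "cinner (f - v) d = 0"
  proof (cases "d = 0")
    case False
    then have "cinner d d \<noteq> 0"
      by (simp add: cinner_self)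
    then show ?thesis
      by (simp add: v_def c_def cinner_diff_left cinner_add_left cinner_scaleC_left)
  qed auto
  moreover have "cinner (f - v) q = 0"
    using B q(1) by blast
  ultimately have a: "cinner (f - v) a = 0"
    by (simp add: d_def cinner_diff_right)
  have "cinner (f - v) w = 0" if "w \<in> cspan (insert a B)" for w
    using that by (rule cinner_cspan_eq_0) (auto intro: a B complex_vector.span_base)
  with v_in show ?case by blast
qed

text \<open>Any element of the span that is close to \<open>f\<close> bounds the projection error,
  so the projection itself never has to be computed. Finiteness of \<open>B\<close> gives existence,
  which with uniqueness makes the \<open>THE\<close> in \<open>orth_proj\<close> meaningful;
  minimality is Pythagoras.\<close>

lemma norm_diff_orth_proj_le:
  fixes f :: "'a::chilbert_space"
  assumes "finite B" and w: "w \<in> cspan B"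
  shows "norm (f - orth_proj (cspan B) f) \<le> norm (f - w)"
proof -
  let ?P = "\<lambda>v. v \<in> cspan B \<and> (\<forall>w\<in>cspan B. cinner (f - v) w = 0)"
  obtain v where v: "?P v"
    using ex_orthogonal_projection [OF assms(1)] by blast
  have uniq: "u = v" if u: "?P u" for u
  proof -
    have "u - v \<in> cspan B"
      using u v by (simp add: complex_vector.span_diff)
    \<comment> \<open>The two residuals differ by \<open>u - v\<close>, so subtracting their
      orthogonality relations tests \<open>u - v\<close> against itself.\<close>
    then have "cinner (f - v) (u - v) - cinner (f - u) (u - v) = 0"
      using u v by simp
    then have "cinner (u - v) (u - v) = 0"
      by (simp add: cinner_diff_left)
    then show ?thesis
      by (simp add: cinner_self)
  qed
  have eq: "orth_proj (cspan B) f = v"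
    unfolding orth_proj_def by (rule the_equality [where P = ?P, OF v uniq])
  have "v - w \<in> cspan B"
    using v w by (simp add: complex_vector.span_diff)
  then have "inner (f - v) (v - w) = 0"
    using v by (simp add: inner_eq_Re_cinner)
  then have "(norm ((f - v) + (v - w)))\<^sup>2 = (norm (f - v))\<^sup>2 + (norm (v - w))\<^sup>2"
    by (intro norm_add_Pythagorean) (simp add: orthogonal_def)
  then have "(norm (f - v))\<^sup>2 \<le> (norm (f - w))\<^sup>2"
    by simp
  then show ?thesis
    unfolding eq by (rule power2_le_imp_le) simp
qed

section \<open>Bessel bounds for analysis and synthesis\<close>

lemma frame_upper_bound:
  assumes "frame J (e :: 'j \<Rightarrow> 'a::chilbert_space)"
  obtains B where "B > 0"
    and "\<And>T f. finite T \<Longrightarrow> T \<subseteq> J \<Longrightarrow> (\<Sum>j\<in>T. (cmod (cinner f (e j)))\<^sup>2) \<le> B * (norm f)\<^sup>2"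
proof -
  obtain B where B: "B > 0"
    "\<And>f. (\<lambda>j. (cmod (cinner f (e j)))\<^sup>2) summable_on J"
    "\<And>f. (\<Sum>\<^sub>\<infinity>j\<in>J. (cmod (cinner f (e j)))\<^sup>2) \<le> B * (norm f)\<^sup>2"
    using assms unfolding frame_def by blast
  have "(\<Sum>j\<in>T. (cmod (cinner f (e j)))\<^sup>2) \<le> B * (norm f)\<^sup>2" if "finite T" "T \<subseteq> J" for T f
    using finite_sum_le_infsum [OF B(2) that, of f] B(3) [of f] by simp
  with B(1) that show thesis by blast
qed

text \<open>Synthesis is adjoint to analysis and therefore inherits its bound. Concretely, the
  squared norm of the sum \<open>v\<close> is expanded as the sum of
  \<open>c j * cinner (h j) v\<close>; Cauchy-Schwarz and the Bessel bound at \<open>v\<close>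
  produce a factor \<open>(norm v)^2\<close>, which is then cancelled.\<close>

lemma norm_synthesis_le:
  fixes h :: "'j \<Rightarrow> 'a::chilbert_space"
  assumes B: "B > 0"
    and bessel: "\<And>f. (\<Sum>j\<in>T. (cmod (cinner f (h j)))\<^sup>2) \<le> B * (norm f)\<^sup>2"
  shows "(norm (\<Sum>j\<in>T. c j *\<^sub>C h j))\<^sup>2 \<le> B * (\<Sum>j\<in>T. (cmod (c j))\<^sup>2)"
proof -
  define v where "v = (\<Sum>j\<in>T. c j *\<^sub>C h j)"
  define S where "S = (\<Sum>j\<in>T. (cmod (c j))\<^sup>2)"
  have S: "S \<ge> 0"
    by (simp add: S_def sum_nonneg)
  have "(norm v)\<^sup>2 = cmod (cinner v v)"
    by (simp add: cinner_self norm_power)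
  also have "\<dots> = cmod (\<Sum>j\<in>T. c j * cinner (h j) v)"
    using cinner_sum_left [of "\<lambda>j. c j *\<^sub>C h j" T v]
    by (simp add: cinner_scaleC_left flip: v_def)
  also have "\<dots> \<le> (\<Sum>j\<in>T. cmod (c j) * cmod (cinner v (h j)))"
    by (intro sum_norm_le) (metis cinner_commute complex_mod_cnj norm_mult order_refl)
  finally have 1: "(norm v)\<^sup>2 \<le> (\<Sum>j\<in>T. cmod (c j) * cmod (cinner v (h j)))" .
  have "((norm v)\<^sup>2)\<^sup>2 \<le> (\<Sum>j\<in>T. cmod (c j) * cmod (cinner v (h j)))\<^sup>2"
    using 1 by (intro power_mono) auto
  also have "\<dots> \<le> S * (\<Sum>j\<in>T. (cmod (cinner v (h j)))\<^sup>2)"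
    unfolding S_def by (rule Cauchy_Schwarz_ineq_sum)
  also have "\<dots> \<le> S * (B * (norm v)\<^sup>2)"
    using S bessel by (intro mult_left_mono)
  finally have 2: "(norm v)\<^sup>2 * (norm v)\<^sup>2 \<le> (B * S) * (norm v)\<^sup>2"
    by (simp add: power2_eq_square mult_ac)
  have "(norm v)\<^sup>2 \<le> B * S"
  proof (cases "v = 0")
    case False
    then show ?thesis
      by (intro mult_right_le_imp_le [OF 2]) simp
  qed (use B S in simp)
  then show ?thesis
    by (simp add: v_def S_def)
qed

section \<open>Unitary representations and the voice transform\<close>

text \<open>Covariance: acting by \<open>z\<close> on \<open>f\<close> becomes a left translation of
  the argument of the voice transform.\<close>

lemma unitary_rep_cinner:
  assumes "unitary_rep \<pi>"
  shows "cinner (\<pi> z f) (\<pi> w g) = cinner f (\<pi> (- z + w) g)"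
proof -
  have "\<pi> w g = \<pi> z (\<pi> (- z + w) g)"
    using assms unfolding unitary_rep_def by (metis add_minus_cancel comp_apply)
  then show ?thesis
    using assms unfolding unitary_rep_def unitary_op_def by metis
qed

lemma unitary_rep_norm:
  assumes "unitary_rep \<pi>"
  shows "norm (\<pi> z f) = norm f"
proof -
  have "cinner (\<pi> z f) (\<pi> z f) = cinner f f"
    using assms unfolding unitary_rep_def unitary_op_def by metis
  then show ?thesis
    unfolding cinner_self of_real_eq_iff by (simp add: power2_eq_iff_nonneg)
qed

text \<open>The homomorphism property makes \<open>\<pi> 0\<close> idempotent, and a surjective
  idempotent map is the identity.\<close>

lemma unitary_rep_zero:
  assumes "unitary_rep \<pi>"
  shows "\<pi> 0 f = f"
proof -
  obtain g where "f = \<pi> 0 g"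
    using assms unfolding unitary_rep_def unitary_op_def surj_def by metis
  then show ?thesis
    using assms unfolding unitary_rep_def by (metis add_0 comp_apply)
qed

text \<open>In its second argument \<open>cinner\<close> is only conjugate-linear over the complex
  numbers, but it is real-linear and bounded, which suffices for continuity.\<close>

lemma continuous_on_cinner_right:
  fixes k :: "'b::topological_space \<Rightarrow> 'a::chilbert_space"
  assumes "continuous_on S k"
  shows "continuous_on S (\<lambda>x. cinner f (k x))"
proof -
  have "bounded_linear (cinner f)"
  proof (rule bounded_linear_intro)
    show "cinner f (r *\<^sub>R x) = r *\<^sub>R cinner f x" for r x
      by (simp add: cinner_scaleC_right scaleR_conv_of_real flip: scaleC_of_real)
    show "norm (cinner f x) \<le> norm x * norm f" for x
      using cmod_cinner_le [of f x] by (simp add: mult.commute)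
  qed (rule cinner_add_right)
  then show ?thesis
    using assms by (rule bounded_linear.continuous_on)
qed

lemma continuous_on_voice_transform:
  assumes "unitary_rep \<pi>"
  shows "continuous_on UNIV (voice_transform \<pi> g f)"
  using assms unfolding voice_transform_def [abs_def] unitary_rep_def
  by (intro continuous_on_cinner_right) blast

lemma cmod_voice_transform_le:
  assumes "unitary_rep \<pi>"
  shows "cmod (voice_transform \<pi> g f x) \<le> norm f * norm g"
  unfolding voice_transform_def
  using cmod_cinner_le [of f "\<pi> x g"] unitary_rep_norm [OF assms] by simp

section \<open>Translates, compact products and relatively separated points\<close>

lemma open_elt_set_plus:
  fixes Q :: "'g::topological_group_add set"
  assumes "open Q"
  shows "open (w +o Q)"
proof -
  have "w +o Q = (\<lambda>x. - w + x) -` Q"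
    by (force simp: elt_set_plus_def)
  also have "open \<dots>"
    using assms by (intro open_vimage continuous_intros)
  finally show ?thesis .
qed

lemma mem_elt_set_plus_iff: "x \<in> (w :: 'g::group_add) +o Q \<longleftrightarrow> - w + x \<in> Q"
  by (force simp: elt_set_plus_def)

lemma compact_set_plus:
  fixes K L :: "'g::topological_monoid_add set"
  assumes "compact K" and "compact L"
  shows "compact (K + L)"
proof -
  have "K + L = (\<lambda>p. fst p + snd p) ` (K \<times> L)"
    by (force simp: set_plus_def)
  then show ?thesis
    using assms by (auto intro!: compact_continuous_image compact_Times continuous_intros)
qed

lemma compact_elt_set_plus:
  fixes K :: "'g::topological_monoid_add set"
  assumes "compact K"
  shows "compact (w +o K)"
proof -
  have "w +o K = (\<lambda>x. w + x) ` K"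
    by (force simp: elt_set_plus_def)
  then show ?thesis
    using assms by (auto intro!: compact_continuous_image continuous_intros)
qed

lemma compact_cover_translates:
  fixes K :: "'g::topological_group_add set"
  assumes "compact K" and "open Q" and "0 \<in> Q"
  obtains D where "finite D" and "K \<subseteq> (\<Union>w\<in>D. w +o Q)"
proof -
  have "w \<in> w +o Q" for w
    using assms(3) by (simp add: mem_elt_set_plus_iff)
  then have "K \<subseteq> (\<Union>w\<in>UNIV. w +o Q)"
    by blast
  then show thesis
    using compactE_image [OF assms(1), of UNIV "\<lambda>w. w +o Q"] that open_elt_set_plus [OF assms(2)]
    by metis
qed

text \<open>Testing the upper frame bound on \<open>\<pi> w g\<close> shows that only boundedly many of the points
  \<open>x j\<close> lie in a translate of the neighborhood on which \<open>\<bar>\<langle>g, \<pi> q g\<rangle>\<bar> > \<parallel>g\<parallel>\<^sup>2 / 2\<close>.\<close>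

lemma frame_relatively_separated:
  fixes \<pi> :: "'g::{topological_group_add, t2_space} \<Rightarrow> 'a::chilbert_space \<Rightarrow> 'a"
  assumes rep: "unitary_rep \<pi>" and g: "g \<noteq> 0" and fr: "frame J (\<lambda>j. \<pi> (x j) g)"
  obtains Q N where "open Q" and "0 \<in> Q"
    and "\<forall>w. finite {j \<in> J. x j \<in> w +o Q} \<and> card {j \<in> J. x j \<in> w +o Q} \<le> N"
proof -
  obtain B where B: "B > 0"
    "\<And>T f. finite T \<Longrightarrow> T \<subseteq> J \<Longrightarrow>
       (\<Sum>j\<in>T. (cmod (cinner f (\<pi> (x j) g)))\<^sup>2) \<le> B * (norm f)\<^sup>2"
    using frame_upper_bound [OF fr] by metis
  define r where "r = (norm g)\<^sup>2 / 2"
  define Q where "Q = {q. r < cmod (cinner g (\<pi> q g))}"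
  \<comment> \<open>Each index counted contributes at least \<open>r^2\<close> to the frame sum of
    \<open>\<pi> w g\<close>, which is at most \<open>B * (norm g)^2\<close>. Indices rather than
    points are counted, since \<open>x\<close> may repeat values.\<close>
  define N where "N = nat \<lfloor>B * (norm g)\<^sup>2 / r\<^sup>2\<rfloor>"
  have r: "r > 0"
    using g by (simp add: r_def)
  have "continuous_on UNIV (\<lambda>q. cinner g (\<pi> q g))"
    using continuous_on_voice_transform [OF rep, of g g]
    by (simp add: voice_transform_def [abs_def])
  then have "open Q"
    unfolding Q_def by (intro open_Collect_less continuous_intros)
  moreover have "0 \<in> Q"
    using g by (simp add: Q_def r_def unitary_rep_zero [OF rep] cinner_self norm_power)
  moreover have "finite {j \<in> J. x j \<in> w +o Q} \<and> card {j \<in> J. x j \<in> w +o Q} \<le> N" for w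
  proof (rule finite_if_finite_subsets_card_bdd)
    fix T assume T: "T \<subseteq> {j \<in> J. x j \<in> w +o Q}" "finite T"
    have "r\<^sup>2 \<le> (cmod (cinner (\<pi> w g) (\<pi> (x j) g)))\<^sup>2" if "j \<in> T" for j
      using that T r
      by (intro power_mono)
        (auto simp: unitary_rep_cinner [OF rep] mem_elt_set_plus_iff Q_def subset_iff)
    then have "real (card T) * r\<^sup>2 \<le> (\<Sum>j\<in>T. (cmod (cinner (\<pi> w g) (\<pi> (x j) g)))\<^sup>2)"
      by (rule sum_bounded_below)
    also have "\<dots> \<le> B * (norm g)\<^sup>2"
      using B(2) [of T "\<pi> w g"] T unitary_rep_norm [OF rep] by auto
    finally show "card T \<le> N"
      using r by (simp add: N_def le_nat_floor pos_le_divide_eq)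
  qed
  ultimately show thesis
    using that by blast
qed

section \<open>Haar measure and tails of square-integrable semicontinuous functions\<close>

lemma
  assumes "left_haar_measure \<mu>"
  shows left_haar_measure_sets: "sets \<mu> = sets borel"
    and left_haar_measure_nonzero: "emeasure \<mu> UNIV \<noteq> 0"
    and left_haar_measure_translate: "A \<in> sets borel \<Longrightarrow> emeasure \<mu> (w +o A) = emeasure \<mu> A"
    and left_haar_measure_compact: "compact K \<Longrightarrow> emeasure \<mu> K < \<infinity>"
    and left_haar_measure_inner_open:
      "open W \<Longrightarrow> emeasure \<mu> W = (SUP K\<in>{K. compact K \<and> K \<subseteq> W}. emeasure \<mu> K)"
  using assms unfolding left_haar_measure_def by meson+

text \<open>If \<open>Q\<close> were null, so would be its translates, and with them every compact
  set, being covered by finitely many. Inner regularity on the open set \<open>UNIV\<close> would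
  then make the whole measure vanish.\<close>

lemma left_haar_measure_open_pos:
  fixes \<mu> :: "'g::{topological_group_add, t2_space} measure"
  assumes haar: "left_haar_measure \<mu>" and Q: "open Q" "0 \<in> Q"
  shows "emeasure \<mu> Q > 0"
proof (rule ccontr)
  assume "\<not> emeasure \<mu> Q > 0"
  then have Q0: "emeasure \<mu> Q = 0"
    by (simp add: not_gr_zero)
  have sets: "sets \<mu> = sets borel"
    using haar by (rule left_haar_measure_sets)
  have "emeasure \<mu> K = 0" if K: "compact K" for K
  proof -
    obtain D where D: "finite D" "K \<subseteq> (\<Union>w\<in>D. w +o Q)"
      using compact_cover_translates [OF K Q] by blast
    have m: "w +o Q \<in> sets \<mu>" for w
      unfolding sets using open_elt_set_plus [OF Q(1)] by auto
    have "emeasure \<mu> K \<le> emeasure \<mu> (\<Union>w\<in>D. w +o Q)"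
      using D m by (intro emeasure_mono sets.finite_UN) auto
    also have "\<dots> \<le> (\<Sum>w\<in>D. emeasure \<mu> (w +o Q))"
      using D m by (intro emeasure_subadditive_finite) auto
    also have "\<dots> = 0"
      using Q(1) Q0 by (simp add: left_haar_measure_translate [OF haar])
    finally show ?thesis by simp
  qed
  then have "(SUP K\<in>{K. compact K \<and> K \<subseteq> UNIV}. emeasure \<mu> K) = 0"
    by (auto intro!: antisym SUP_least)
  then show False
    using left_haar_measure_inner_open [OF haar open_UNIV] left_haar_measure_nonzero [OF haar]
    by simp
qed

text \<open>The local maximum function is a supremum, over shifts \<open>u\<close> in
  \<open>U\<close>, of continuous functions, hence lower semicontinuous.\<close>

lemma open_local_max_greater:
  fixes F :: "'g::topological_monoid_add \<Rightarrow> complex"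
  assumes "continuous_on UNIV F"
  shows "open {x. c < local_max U F x}"
proof -
  have "{x. c < local_max U F x} = (\<Union>u\<in>U. {x. c < ennreal (cmod (F (x + u)))})"
    by (auto simp: local_max_def less_SUP_iff elt_set_plus_def)
  moreover have "open {x. c < ennreal (cmod (F (x + u)))}" for u
    by (intro open_Collect_less continuous_intros continuous_on_ennreal
        continuous_on_compose2 [OF assms]) auto
  ultimately show ?thesis by auto
qed

text \<open>A Haar measure need not be \<open>\<sigma>\<close>-finite and is inner regular on open sets only, so the compact
  set is found inside a superlevel set of \<open>\<psi>\<close>: this is open by semicontinuity and of finite measure.\<close>

lemma nn_integral_square_compact_tail:
  fixes \<psi> :: "'g::t2_space \<Rightarrow> ennreal"
  assumes sets: "sets \<mu> = sets borel"
    and inner: "\<And>W. open W \<Longrightarrow> emeasure \<mu> W = (SUP K\<in>{K. compact K \<and> K \<subseteq> W}. emeasure \<mu> K)"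
    and lsc: "\<And>c. open {x. c < \<psi> x}"
    and bdd: "\<And>x. \<psi> x \<le> ennreal b"
    and fin: "(\<integral>\<^sup>+x. (\<psi> x)\<^sup>2 \<partial>\<mu>) < \<infinity>"
    and e: "e > (0 :: real)"
  obtains K where "compact K" and "(\<integral>\<^sup>+x. (\<psi> x)\<^sup>2 * indicator (- K) x \<partial>\<mu>) \<le> ennreal e"
proof -
  have "\<psi> \<in> borel_measurable borel"
    by (rule borel_measurableI_greater) (simp add: lsc)
  then have \<psi> [measurable]: "\<psi> \<in> borel_measurable \<mu>"
    using measurable_cong_sets [OF sets refl] by blast
  \<comment> \<open>This measure is finite, and the integral to be made small is its value at
    \<open>- K\<close>.\<close>
  define \<nu> where "\<nu> = density \<mu> (\<lambda>x. (\<psi> x)\<^sup>2)"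
  have sets\<nu> [simp]: "sets \<nu> = sets borel"
    by (simp add: \<nu>_def sets)
  have \<nu>: "emeasure \<nu> A = (\<integral>\<^sup>+x. (\<psi> x)\<^sup>2 * indicator A x \<partial>\<mu>)" if "A \<in> sets borel" for A
    using that by (simp add: \<nu>_def emeasure_density sets)
  define W where "W n = {x. ennreal (1 / Suc n) < \<psi> x}" for n
  have W: "open (W n)" for n
    by (simp add: W_def lsc)
  have \<nu>_fin: "emeasure \<nu> A \<noteq> \<infinity>" if "A \<in> sets borel" for A
  proof -
    have "emeasure \<nu> A \<le> (\<integral>\<^sup>+x. (\<psi> x)\<^sup>2 \<partial>\<mu>)"
      unfolding \<nu> [OF that] by (intro nn_integral_mono) (auto simp: indicator_def)
    then show ?thesis using fin by auto
  qed
  have dec: "decseq (\<lambda>n. - W n)"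
  proof (rule decseq_SucI)
    fix n
    have "ennreal (1 / Suc (Suc n)) \<le> ennreal (1 / Suc n)"
      by (intro ennreal_leI) (simp add: frac_le)
    then have "W n \<subseteq> W (Suc n)"
      unfolding W_def using order_le_less_trans by blast
    then show "- W (Suc n) \<subseteq> - W n"
      by blast
  qed
  \<comment> \<open>Continuity from above for the finite measure \<open>\<nu>\<close>: the
    complements of the \<open>W n\<close> decrease to the zero set of \<open>\<psi>\<close>, which
    is \<open>\<nu>\<close>-null.\<close>
  have "(INF n. emeasure \<nu> (- W n)) = emeasure \<nu> (\<Inter>n. - W n)"
    by (intro INF_emeasure_decseq dec) (use W \<nu>_fin in \<open>auto intro!: borel_comp\<close>)
  also have "(\<Inter>n. - W n) = {x. \<psi> x = 0}"
  proof safe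
    fix x assume x: "x \<in> (\<Inter>n. - W n)"
    show "\<psi> x = 0"
    proof (rule ccontr)
      assume "\<psi> x \<noteq> 0"
      moreover have "\<psi> x < \<infinity>"
        using bdd [of x] by (metis ennreal_less_top infinity_ennreal_def order_le_less_trans)
      ultimately have "enn2real (\<psi> x) > 0"
        by (simp add: enn2real_positive_iff zero_less_iff_neq_zero)
      then obtain n where "1 / Suc n < enn2real (\<psi> x)"
        using nat_approx_posE by blast
      then have "ennreal (1 / Suc n) < ennreal (enn2real (\<psi> x))"
        by (simp add: ennreal_less_iff)
      then have "x \<in> W n"
        using \<open>\<psi> x < \<infinity>\<close> by (simp add: W_def)
      with x show False by blast
    qed
  qed (auto simp: W_def)
  also have "emeasure \<nu> \<dots> = 0"
  proof -
    have "{x. \<psi> x = 0} = - {x. 0 < \<psi> x}"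
      by (auto simp: zero_less_iff_neq_zero)
    also have "\<dots> \<in> sets borel"
      using lsc by (auto intro!: borel_comp)
    finally have "emeasure \<nu> {x. \<psi> x = 0} = (\<integral>\<^sup>+x. (\<psi> x)\<^sup>2 * indicator {x. \<psi> x = 0} x \<partial>\<mu>)"
      by (rule \<nu>)
    also have "\<dots> = (\<integral>\<^sup>+x. 0 \<partial>\<mu>)"
      by (intro nn_integral_cong) (simp add: indicator_def)
    finally show ?thesis by simp
  qed
  finally have "(INF n. emeasure \<nu> (- W n)) < ennreal (e / 2)"
    using e by simp
  then obtain n where n: "emeasure \<nu> (- W n) < ennreal (e / 2)"
    by (auto simp: INF_less_iff)
  \<comment> \<open>Chebyshev's inequality: \<open>\<psi>\<close> exceeds \<open>1 / Suc n\<close>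
    on \<open>W n\<close>.\<close>
  have W_fin: "emeasure \<mu> (W n) \<noteq> \<infinity>"
  proof
    assume top: "emeasure \<mu> (W n) = \<infinity>"
    have "(ennreal (1 / Suc n))\<^sup>2 * emeasure \<mu> (W n)
        = (\<integral>\<^sup>+x. (ennreal (1 / Suc n))\<^sup>2 * indicator (W n) x \<partial>\<mu>)"
      using W by (simp add: nn_integral_cmult_indicator sets)
    also have "\<dots> \<le> (\<integral>\<^sup>+x. (\<psi> x)\<^sup>2 \<partial>\<mu>)"
      by (intro nn_integral_mono) (auto simp: indicator_def W_def intro!: power_mono)
    finally show False
      using fin top by (auto simp: ennreal_mult_top top_unique ennreal_eq_0_iff)
  qed
  \<comment> \<open>The density is at most \<open>b^2\<close>, so a remainder \<open>W n - K\<close>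
    of \<open>\<mu>\<close>-measure at most \<open>d\<close> has \<open>\<nu>\<close>-measure at
    most \<open>e / 2\<close>. The summand 1 keeps the denominator positive when
    \<open>b = 0\<close>.\<close>
  define d where "d = e / (2 * (b\<^sup>2 + 1))"
  have d: "d > 0" "b\<^sup>2 * d \<le> e / 2"
  proof -
    have "b\<^sup>2 + 1 > 0"
      by (simp add: add_nonneg_pos)
    then show "d > 0" "b\<^sup>2 * d \<le> e / 2"
      using e by (simp_all add: d_def field_simps)
  qed
  have "{K. compact K \<and> K \<subseteq> W n} \<noteq> {}"
    using compact_empty by blast
  then obtain K where K: "compact K" "K \<subseteq> W n" "emeasure \<mu> (W n) < emeasure \<mu> K + ennreal d"
    using SUP_approx_ennreal [OF d(1) _ inner [OF W [of n]] W_fin] by blast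
  have K_sets: "K \<in> sets borel"
    using K(1) by (auto intro: borel_closed compact_imp_closed)
  have D_sets: "W n - K \<in> sets borel"
    using K_sets W by auto
  have "emeasure \<mu> (W n - K) = emeasure \<mu> (W n) - emeasure \<mu> K"
    using W_fin K K_sets W emeasure_mono [OF K(2), of \<mu>]
    by (intro emeasure_Diff) (auto simp: sets top_unique)
  also have "\<dots> \<le> ennreal d"
    using less_imp_le [OF K(3)] W_fin by (simp add: ennreal_minus_le_iff add.commute)
  finally have D: "emeasure \<mu> (W n - K) \<le> ennreal d" .
  have "emeasure \<nu> (W n - K) \<le> (\<integral>\<^sup>+x. (ennreal b)\<^sup>2 * indicator (W n - K) x \<partial>\<mu>)"
    unfolding \<nu> [OF D_sets]
    by (intro nn_integral_mono mult_right_mono power_mono bdd) auto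
  also have "\<dots> = (ennreal b)\<^sup>2 * emeasure \<mu> (W n - K)"
    using D_sets by (simp add: nn_integral_cmult_indicator sets)
  \<comment> \<open>The sign of \<open>b\<close> is not prescribed; for negative \<open>b\<close>
    the value \<open>ennreal b\<close> is 0.\<close>
  also have "\<dots> \<le> ennreal (b\<^sup>2) * ennreal d"
    using D by (intro mult_mono) (cases "b \<ge> 0"; simp add: ennreal_power ennreal_neg)+
  also have "\<dots> \<le> ennreal (e / 2)"
    using d by (simp add: ennreal_mult [symmetric] ennreal_leI)
  finally have 2: "emeasure \<nu> (W n - K) \<le> ennreal (e / 2)" .
  have "- K = - W n \<union> (W n - K)"
    using K(2) by blast
  then have "emeasure \<nu> (- K) \<le> emeasure \<nu> (- W n) + emeasure \<nu> (W n - K)"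
    using D_sets W by (metis borel_comp borel_open emeasure_subadditive sets\<nu>)
  also have "\<dots> \<le> ennreal (e / 2) + ennreal (e / 2)"
    using n 2 by (intro add_mono) auto
  also have "\<dots> = ennreal e"
    using e by (simp flip: ennreal_plus)
  finally have "(\<integral>\<^sup>+x. (\<psi> x)\<^sup>2 * indicator (- K) x \<partial>\<mu>) \<le> ennreal e"
    using K_sets by (simp add: \<nu> borel_comp)
  with K(1) that show thesis by blast
qed

section \<open>Sampling sums controlled by the local maximum function\<close>

text \<open>By left invariance each term times the measure of \<open>Q\<close> is the integral of a
  constant over \<open>p j +o Q\<close>. There the local maximum function dominates that constant,
  because \<open>Q\<close> is symmetric and contained in \<open>U\<close>; every \<open>u\<close>
  lies in at most \<open>N\<close> of these translates, and in none of them if \<open>u\<close> is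
  in \<open>L\<close>.\<close>

lemma sampling_sum_le_local_max:
  fixes \<mu> :: "'g::{topological_group_add, t2_space} measure"
  assumes haar: "left_haar_measure \<mu>"
    and meas [measurable]: "local_max U F \<in> borel_measurable \<mu>"
    and Q: "open Q" "uminus ` Q \<subseteq> Q" "Q \<subseteq> U"
    and T: "finite T" and N: "\<And>u. card {j \<in> T. p j \<in> u +o Q} \<le> N"
    and L: "compact L" "\<And>j. j \<in> T \<Longrightarrow> p j \<notin> L + U"
  shows "(\<Sum>j\<in>T. (ennreal (cmod (F (p j))))\<^sup>2) * emeasure \<mu> Q
    \<le> of_nat N * (\<integral>\<^sup>+u. (local_max U F u)\<^sup>2 * indicator (- L) u \<partial>\<mu>)"
proof -
  have sets: "sets \<mu> = sets borel"
    using haar by (rule left_haar_measure_sets)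
  have m [measurable]: "p j +o Q \<in> sets \<mu>" for j
    unfolding sets using open_elt_set_plus [OF Q(1)] by auto
  have [measurable]: "- L \<in> sets \<mu>"
    unfolding sets using L(1) by (intro borel_comp borel_closed compact_imp_closed)
  have "(\<Sum>j\<in>T. (ennreal (cmod (F (p j))))\<^sup>2) * emeasure \<mu> Q
      = (\<Sum>j\<in>T. (ennreal (cmod (F (p j))))\<^sup>2 * emeasure \<mu> (p j +o Q))"
    using Q(1) by (simp add: left_haar_measure_translate [OF haar] sum_distrib_right)
  also have "\<dots> = (\<integral>\<^sup>+u. (\<Sum>j\<in>T. (ennreal (cmod (F (p j))))\<^sup>2 * indicator (p j +o Q) u) \<partial>\<mu>)"
    by (subst nn_integral_sum) (auto simp: nn_integral_cmult_indicator)
  also have "\<dots> \<le> (\<integral>\<^sup>+u. of_nat N * ((local_max U F u)\<^sup>2 * indicator (- L) u) \<partial>\<mu>)"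
  proof (rule nn_integral_mono)
    fix u
    let ?R = "(local_max U F u)\<^sup>2 * indicator (- L) u :: ennreal"
    let ?T = "{j \<in> T. p j \<in> u +o Q}"
    have "(ennreal (cmod (F (p j))))\<^sup>2 * indicator (p j +o Q) u
        \<le> (if p j \<in> u +o Q then ?R else 0)" if j: "j \<in> T" for j
    proof (cases "u \<in> p j +o Q")
      case True
      then obtain q where q: "q \<in> Q" "u = p j + q"
        by (auto simp: elt_set_plus_def)
      then have q': "- q \<in> Q" "p j = u + - q"
        using Q(2) by (auto simp: add.assoc)
      then have pu: "- u + p j = - q"
        by (simp only: minus_add_cancel)
      \<comment> \<open>Otherwise \<open>p j = u + - q\<close> would lie in
        \<open>L + U\<close>.\<close>
      have "u \<notin> L"
        using L(2) [OF j] q' Q(3) by (metis set_plus_intro subsetD)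
      moreover have "p j \<in> u +o U"
        using q'(1) Q(3) by (auto simp: mem_elt_set_plus_iff pu)
      then have "ennreal (cmod (F (p j))) \<le> local_max U F u"
        unfolding local_max_def by (rule SUP_upper)
      moreover have "p j \<in> u +o Q"
        using q'(1) by (simp add: mem_elt_set_plus_iff pu)
      ultimately show ?thesis
        by (auto simp: indicator_def intro!: power_mono)
    qed simp
    then have "(\<Sum>j\<in>T. (ennreal (cmod (F (p j))))\<^sup>2 * indicator (p j +o Q) u)
        \<le> (\<Sum>j\<in>T. if p j \<in> u +o Q then ?R else 0)"
      by (rule sum_mono)
    also have "\<dots> = of_nat (card ?T) * ?R"
      using T by (simp add: sum.If_cases Int_def)
    also have "\<dots> \<le> of_nat N * ?R"
      using N [of u] by (intro mult_right_mono) auto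
    finally show "(\<Sum>j\<in>T. (ennreal (cmod (F (p j))))\<^sup>2 * indicator (p j +o Q) u) \<le> of_nat N * ?R" .
  qed
  also have "\<dots> = of_nat N * (\<integral>\<^sup>+u. (local_max U F u)\<^sup>2 * indicator (- L) u \<partial>\<mu>)"
    by (rule nn_integral_cmult) measurable
  finally show ?thesis .
qed

text \<open>The compact set is chosen before \<open>T\<close> and \<open>p\<close>, so a single one
  serves all translates of the sample points. It is the product with \<open>U\<close> of a compact
  set off which the squared local maximum function has small integral.\<close>

lemma nice_sampling_tail:
  fixes \<mu> :: "'g::{topological_group_add, t2_space} measure"
  assumes haar: "left_haar_measure \<mu>" and U: "compact U" and rep: "unitary_rep \<pi>"
    and nice: "nice \<mu> U \<pi> g"
    and Q: "open Q" "0 \<in> Q" "uminus ` Q \<subseteq> Q" "Q \<subseteq> U"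
    and \<delta>: "\<delta> > 0"
  obtains L where "compact L"
    and "\<forall>T p. finite T \<longrightarrow> (\<forall>u. card {j \<in> T. p j \<in> u +o Q} \<le> N) \<longrightarrow> (\<forall>j\<in>T. p j \<notin> L) \<longrightarrow>
      (\<Sum>j\<in>T. (cmod (voice_transform \<pi> g f (p j)))\<^sup>2) \<le> \<delta>"
proof -
  let ?F = "voice_transform \<pi> g f"
  have meas: "local_max U ?F \<in> borel_measurable \<mu>"
    and fin: "(\<integral>\<^sup>+x. (local_max U ?F x)\<^sup>2 \<partial>\<mu>) < \<infinity>"
    using nice by (auto simp: nice_def in_amalgam_def)
  note sets = left_haar_measure_sets [OF haar]
  have "U \<in> sets \<mu>"
    unfolding sets using U by (intro borel_closed compact_imp_closed)
  then have "emeasure \<mu> Q < \<infinity>"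
    using emeasure_mono [OF Q(4)] left_haar_measure_compact [OF haar U] order_le_less_trans
    by blast
  then have Qm: "emeasure \<mu> Q = ennreal (measure \<mu> Q)"
    by (simp add: emeasure_eq_ennreal_measure less_top)
  have Qpos: "measure \<mu> Q > 0"
    using left_haar_measure_open_pos [OF haar Q(1,2)] unfolding Qm by simp
  \<comment> \<open>Dividing by \<open>Suc N\<close> instead of \<open>N\<close> covers the case
    \<open>N = 0\<close>.\<close>
  define e where "e = \<delta> * measure \<mu> Q / real (Suc N)"
  have e: "e > 0" "real N * e \<le> \<delta> * measure \<mu> Q"
    using \<delta> Qpos by (auto simp: e_def field_simps)
  have bdd: "local_max U ?F x \<le> ennreal (norm f * norm g)" for x
    unfolding local_max_def
    by (intro SUP_least ennreal_leI cmod_voice_transform_le [OF rep])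
  obtain L where L: "compact L"
    "(\<integral>\<^sup>+x. (local_max U ?F x)\<^sup>2 * indicator (- L) x \<partial>\<mu>) \<le> ennreal e"
    using nn_integral_square_compact_tail [OF sets
        left_haar_measure_inner_open [OF haar]
        open_local_max_greater [OF continuous_on_voice_transform [OF rep]] bdd fin e(1)] by blast
  have "(\<Sum>j\<in>T. (cmod (?F (p j)))\<^sup>2) \<le> \<delta>"
    if T: "finite T" "\<And>u. card {j \<in> T. p j \<in> u +o Q} \<le> N" "\<And>j. j \<in> T \<Longrightarrow> p j \<notin> L + U" for T p
  proof -
    let ?S = "\<Sum>j\<in>T. (cmod (?F (p j)))\<^sup>2"
    have "ennreal (?S * measure \<mu> Q) = (\<Sum>j\<in>T. (ennreal (cmod (?F (p j))))\<^sup>2) * emeasure \<mu> Q"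
      by (simp add: Qm ennreal_mult'' ennreal_power flip: sum_ennreal)
    also have "\<dots> \<le> of_nat N * (\<integral>\<^sup>+x. (local_max U ?F x)\<^sup>2 * indicator (- L) x \<partial>\<mu>)"
      by (rule sampling_sum_le_local_max [OF haar meas Q(1,3,4) T(1,2) L(1) T(3)])
    also have "\<dots> \<le> of_nat N * ennreal e"
      using L(2) by (intro mult_left_mono) auto
    also have "\<dots> = ennreal (real N * e)"
      using e by (simp add: ennreal_mult ennreal_of_nat_eq_real_of_nat)
    also have "\<dots> \<le> ennreal (\<delta> * measure \<mu> Q)"
      using e by (intro ennreal_leI)
    finally have "?S * measure \<mu> Q \<le> \<delta> * measure \<mu> Q"
      using \<delta> Qpos by (subst (asm) ennreal_le_iff) auto
    then show ?thesis
      using Qpos by simp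
  qed
  then show thesis
    by (intro that [OF compact_set_plus [OF L(1) U]]) blast
qed

section \<open>Uniform approximation by local spans of the dual frame\<close>

theorem proposition2:
  fixes \<mu> :: "'g::{topological_group_add, t2_space} measure"
    and U :: "'g set"
    and \<pi> :: "'g \<Rightarrow> 'a::chilbert_space \<Rightarrow> 'a"
    and g :: 'a
    and J :: "'j set"
    and x :: "'j \<Rightarrow> 'g"
    and h :: "'j \<Rightarrow> 'a"
  assumes "locally compact (UNIV :: 'g set)"
    and "left_haar_measure \<mu>"
    and "compact U" and "uminus ` U = U" and "0 \<in> interior U"
    and "unitary_rep \<pi>"
    and "square_integrable_rep \<mu> \<pi>"
    and "g \<noteq> 0" and "nice \<mu> U \<pi> g"
    and "frame J (\<lambda>j. \<pi> (x j) g)"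
    and "dual_frame J (\<lambda>j. \<pi> (x j) g) h"
  shows "\<forall>f. \<forall>\<epsilon>>0. \<exists>L. compact L \<and>
    (\<forall>K y. compact K \<longrightarrow>
      (SUP z\<in>y +o K. ennreal (norm (\<pi> z f - orth_proj (local_span J x h (y +o (K + L))) (\<pi> z f))))
        < ennreal \<epsilon>)"
proof (intro allI impI)
  fix f :: 'a and \<epsilon> :: real
  assume \<epsilon>: "\<epsilon> > 0"
  note rep = assms(6)
  obtain Q0 N where Q0: "open Q0" "0 \<in> Q0"
    and sep0: "\<forall>w. finite {j \<in> J. x j \<in> w +o Q0} \<and> card {j \<in> J. x j \<in> w +o Q0} \<le> N"
    using frame_relatively_separated [OF rep assms(8,10)] by blast
  \<comment> \<open>Shrinking into \<open>U\<close> and intersecting with the reflection gives the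
    symmetric neighborhood that the sampling estimate requires; the counting bound passes to
    subsets.\<close>
  define Q1 where "Q1 = Q0 \<inter> interior U"
  define Q where "Q = Q1 \<inter> uminus -` Q1"
  have Q1: "open Q1" "0 \<in> Q1"
    using Q0 assms(5) by (auto simp: Q1_def)
  then have Q: "open Q" "0 \<in> Q" "uminus ` Q \<subseteq> Q"
    unfolding Q_def by (auto intro!: open_Int open_vimage continuous_intros)
  have QU: "Q \<subseteq> U" "Q \<subseteq> Q0"
    using interior_subset by (auto simp: Q_def Q1_def)
  have sep_fin: "finite {j \<in> J. x j \<in> w +o Q}" for w
    by (rule finite_subset [of _ "{j \<in> J. x j \<in> w +o Q0}"])
      (use QU sep0 in \<open>auto simp: mem_elt_set_plus_iff\<close>)
  have sep: "card {j \<in> J. x j \<in> w +o Q} \<le> N" for w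
  proof -
    have "card {j \<in> J. x j \<in> w +o Q} \<le> card {j \<in> J. x j \<in> w +o Q0}"
      using QU sep0 by (intro card_mono) (auto simp: mem_elt_set_plus_iff)
    then show ?thesis
      using sep0 order_trans by blast
  qed
  have dual: "frame J h" "\<And>f. ((\<lambda>j. cinner f (\<pi> (x j) g) *\<^sub>C h j) has_sum f) J"
    using assms(11) by (auto simp: dual_frame_def)
  obtain B where B: "B > 0"
    "\<And>T f. finite T \<Longrightarrow> T \<subseteq> J \<Longrightarrow> (\<Sum>j\<in>T. (cmod (cinner f (h j)))\<^sup>2) \<le> B * (norm f)\<^sup>2"
    using frame_upper_bound [OF dual(1)] by metis
  \<comment> \<open>The synthesis bound turns a coefficient sum of at most \<open>\<delta>\<close>
    into a squared error of at most \<open>B * \<delta>\<close>. Aiming at half of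
    \<open>\<epsilon>\<close> keeps the final inequality strict after taking the supremum.\<close>
  define \<delta> where "\<delta> = (\<epsilon> / 2)\<^sup>2 / B"
  have \<delta>: "\<delta> > 0" "B * \<delta> = (\<epsilon> / 2)\<^sup>2"
    using B(1) \<epsilon> by (auto simp: \<delta>_def)
  obtain L where L: "compact L"
    "\<forall>T p. finite T \<longrightarrow> (\<forall>u. card {j \<in> T. p j \<in> u +o Q} \<le> N) \<longrightarrow> (\<forall>j\<in>T. p j \<notin> L) \<longrightarrow>
      (\<Sum>j\<in>(T :: 'j set). (cmod (voice_transform \<pi> g f (p j)))\<^sup>2) \<le> \<delta>"
    using nice_sampling_tail [OF assms(2,3) rep assms(9) Q QU(1) \<delta>(1)] by blast
  have "norm (\<pi> z f - orth_proj (local_span J x h (y +o (K + L))) (\<pi> z f)) \<le> \<epsilon> / 2"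
    if K: "compact K" and z: "z \<in> y +o K" for K y z
  proof -
    define S where "S = y +o (K + L)"
    define T0 where "T0 = {j \<in> J. x j \<in> S}"
    define c where "c j = cinner (\<pi> z f) (\<pi> (x j) g)" for j
    have "compact S"
      unfolding S_def by (intro compact_elt_set_plus compact_set_plus K L)
    then obtain D where D: "finite D" "S \<subseteq> (\<Union>w\<in>D. w +o Q)"
      using compact_cover_translates [OF _ Q(1,2)] by blast
    have T0: "finite T0"
      by (rule finite_subset [of _ "\<Union>w\<in>D. {j \<in> J. x j \<in> w +o Q}"])
        (use D sep_fin in \<open>auto simp: T0_def\<close>)
    \<comment> \<open>The truncated dual frame expansion is the competitor in the span, to be
      compared with the projection.\<close>
    define w where "w = (\<Sum>j\<in>T0. c j *\<^sub>C h j)"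
    have w: "w \<in> cspan (h ` T0)"
      unfolding w_def
      by (intro complex_vector.span_sum complex_vector.span_scale complex_vector.span_base) auto
    have "((\<lambda>j. c j *\<^sub>C h j) has_sum (\<pi> z f - w)) (J - T0)"
      using dual(2) [of "\<pi> z f"] T0 unfolding w_def c_def
      by (intro has_sum_Diff has_sum_finite) (auto simp: T0_def)
    then have lim: "((\<lambda>T. \<Sum>j\<in>T. c j *\<^sub>C h j) \<longlongrightarrow> \<pi> z f - w) (finite_subsets_at_top (J - T0))"
      by (simp add: has_sum_def)
    have bound: "norm (\<Sum>j\<in>T. c j *\<^sub>C h j) \<le> \<epsilon> / 2" if T: "finite T" "T \<subseteq> J - T0" for T
    proof -
      \<comment> \<open>The counting bound is uniform over translates, so moving the points by
        \<open>- z\<close> merely replaces \<open>u\<close> by \<open>z + u\<close>.\<close>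
      have "card {j \<in> T. - z + x j \<in> u +o Q} \<le> N" for u
      proof -
        have "card {j \<in> T. - z + x j \<in> u +o Q} \<le> card {j \<in> J. x j \<in> (z + u) +o Q}"
          using T by (intro card_mono sep_fin)
            (auto simp: mem_elt_set_plus_iff minus_add add.assoc simp del: add_uminus_conv_diff)
        then show ?thesis
          using sep order_trans by blast
      qed
      moreover have "- z + x j \<notin> L" if j: "j \<in> T" for j
      proof
        assume l: "- z + x j \<in> L"
        obtain k where k: "k \<in> K" "z = y + k"
          using z by (auto simp: elt_set_plus_def)
        \<comment> \<open>A sample point in \<open>L\<close> would put
          \<open>x j = z + (- z + x j)\<close> into the translate by \<open>y\<close> of
          \<open>K + L\<close>, whose indices have been removed.\<close>
        have "x j = y + (k + (- z + x j))"
          using k(2) by (metis add.assoc add_minus_cancel)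
        then have "x j \<in> S"
          unfolding S_def using k l by (metis set_plus_intro set_plus_intro2)
        then show False
          using T j by (auto simp: T0_def)
      qed
      ultimately have "(\<Sum>j\<in>T. (cmod (voice_transform \<pi> g f (- z + x j)))\<^sup>2) \<le> \<delta>"
        using T(1) L(2) by simp
      then have "(\<Sum>j\<in>T. (cmod (c j))\<^sup>2) \<le> \<delta>"
        by (simp add: c_def voice_transform_def unitary_rep_cinner [OF rep])
      moreover have "(norm (\<Sum>j\<in>T. c j *\<^sub>C h j))\<^sup>2 \<le> B * (\<Sum>j\<in>T. (cmod (c j))\<^sup>2)"
        using T B by (intro norm_synthesis_le) auto
      ultimately have "(norm (\<Sum>j\<in>T. c j *\<^sub>C h j))\<^sup>2 \<le> (\<epsilon> / 2)\<^sup>2"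
        using B(1) \<delta>(2) by (smt (verit) mult_left_mono)
      then show ?thesis
        using \<epsilon> by (auto elim: power2_le_imp_le)
    qed
    have "norm (\<pi> z f - orth_proj (cspan (h ` T0)) (\<pi> z f)) \<le> norm (\<pi> z f - w)"
      using T0 w by (intro norm_diff_orth_proj_le) auto
    also have "\<dots> \<le> \<epsilon> / 2"
    \<comment> \<open>The bound on finite partial sums of the remainder passes to the limit along
      the net of finite subsets.\<close>
    proof (rule tendsto_upperbound [OF tendsto_norm [OF lim]])
      show "\<forall>\<^sub>F T in finite_subsets_at_top (J - T0). norm (\<Sum>j\<in>T. c j *\<^sub>C h j) \<le> \<epsilon> / 2"
        by (rule eventually_finite_subsets_at_top_weakI) (rule bound)
    qed simp
    finally show ?thesis
      by (simp add: local_span_def T0_def S_def)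
  qed
  \<comment> \<open>If \<open>K\<close> is empty, the supremum is 0, the least element of
    \<open>ennreal\<close>.\<close>
  then have "(SUP z\<in>y +o K. ennreal (norm (\<pi> z f - orth_proj (local_span J x h (y +o (K + L))) (\<pi> z f))))
      \<le> ennreal (\<epsilon> / 2)" if "compact K" for K y
    using that by (intro SUP_least ennreal_leI)
  moreover have "ennreal (\<epsilon> / 2) < ennreal \<epsilon>"
    using \<epsilon> by (intro ennreal_lessI) auto
  ultimately show "\<exists>L. compact L \<and>
    (\<forall>K y. compact K \<longrightarrow>
      (SUP z\<in>y +o K. ennreal (norm (\<pi> z f - orth_proj (local_span J x h (y +o (K + L))) (\<pi> z f))))
        < ennreal \<epsilon>)"
    using L(1) order_le_less_trans by blast
qed

end
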